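(* For each $p\in[1,\infty)$, there exists a decreasing real sequence $\bm{w}=(w_n:n\in\omega)$ with $\lim_n w_n=1$ for which the weighted backward shift $B_{\bm{w}}$ on $\ell_p$ is pointwise upper frequently hypercyclic, norm hypercyclic, and not norm upper frequently hypercyclic.
   Context: $\omega$ is the set of nonnegative integers. $\ell_p$ is the Banach space of real sequences $(x_n:n\in\omega)$ with $\sum_n|x_n|^p<\infty$. For $\bm{w}=(w_n:n\in\omega)$, $B_{\bm{w}}(x_0,x_1,x_2,\ldots):=(w_1x_1,w_2x_2,w_3x_3,\ldots)$. Given a vector topology $\tau$ on $X$ for which the linear operator $T:X\to X$ is continuous: $T$ is hypercyclic (with respect to $\tau$) if there is $x\in X$ such that $\{n\in\omega:T^nx\in U\}$ is infinite for every nonempty $\tau$-open $U\subseteq X$; $T$ is upper frequently hypercyclic (with respect to $\tau$) if there is $x\in X$ such that $\{n\in\omega:T^nx\in U\}$ has positive upper asymptotic density for every nonempty $\tau$-open $U\subseteq X$, where the upper asymptotic density of $S\subseteq\omega$ is $\limsup_{n\to\infty}|S\cap[0,n)|/(n+1)$. "Norm" refers to $\tau$ being the norm topology, and "pointwise" to $\tau$ being the subspace topology inherited from the product topology of $\mathbf{R}^\omega$. *)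

theory Defs
  imports "HOL-Analysis.Analysis"
begin

definition lp_space :: "real \<Rightarrow> (nat \<Rightarrow> real) set" where
  "lp_space p = {x. summable (\<lambda>n. \<bar>x n\<bar> powr p)}"

definition lp_norm :: "real \<Rightarrow> (nat \<Rightarrow> real) \<Rightarrow> real" where
  "lp_norm p x = (\<Sum>n. \<bar>x n\<bar> powr p) powr (1 / p)"

definition lp_dist :: "real \<Rightarrow> (nat \<Rightarrow> real) \<Rightarrow> (nat \<Rightarrow> real) \<Rightarrow> real" where
  "lp_dist p x y = lp_norm p (\<lambda>n. x n - y n)"

definition lp_norm_topology :: "real \<Rightarrow> (nat \<Rightarrow> real) topology" where
  "lp_norm_topology p = Metric_space.mtopology (lp_space p) (lp_dist p)"

definition lp_pointwise_topology :: "real \<Rightarrow> (nat \<Rightarrow> real) topology" where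
  "lp_pointwise_topology p =
     subtopology (product_topology (\<lambda>_. euclideanreal) UNIV) (lp_space p)"

text \<open>The entry \<open>w 0\<close> is never used.\<close>

definition weighted_shift :: "(nat \<Rightarrow> real) \<Rightarrow> (nat \<Rightarrow> real) \<Rightarrow> nat \<Rightarrow> real" where
  "weighted_shift w x = (\<lambda>n. w (Suc n) * x (Suc n))"

definition upper_density :: "nat set \<Rightarrow> ereal" where
  "upper_density S = limsup (\<lambda>n. ereal (real (card (S \<inter> {0..<n})) / (real n + 1)))"

text \<open>
  In the next two definitions the underlying space is \<open>topspace \<tau>\<close>. They are meant for linear
  operators mapping \<open>topspace \<tau>\<close> continuously to itself; for the weighted shifts with bounded
  weights this is established at the end of this theory.
\<close>

definition hypercyclic :: "'a topology \<Rightarrow> ('a \<Rightarrow> 'a) \<Rightarrow> bool" where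
  "hypercyclic \<tau> T \<longleftrightarrow>
     (\<exists>x \<in> topspace \<tau>. \<forall>U. openin \<tau> U \<and> U \<noteq> {} \<longrightarrow> infinite {n. (T ^^ n) x \<in> U})"

definition upper_frequently_hypercyclic :: "'a topology \<Rightarrow> ('a \<Rightarrow> 'a) \<Rightarrow> bool" where
  "upper_frequently_hypercyclic \<tau> T \<longleftrightarrow>
     (\<exists>x \<in> topspace \<tau>. \<forall>U. openin \<tau> U \<and> U \<noteq> {} \<longrightarrow> upper_density {n. (T ^^ n) x \<in> U} > 0)"


text \<open>
  \<open>lp_dist\<close> is a metric on \<open>lp_space\<close>, so \<open>lp_norm_topology\<close> is the norm topology.
\<close>

lemma powr_convex_nonneg:
  fixes x y t p :: real
  assumes p: "1 \<le> p" and t: "0 \<le> t" "t \<le> 1" and xy: "0 \<le> x" "0 \<le> y"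
  shows "(t * x + (1 - t) * y) powr p \<le> t * x powr p + (1 - t) * y powr p"
proof -
  have scale: "(s * z) powr p \<le> s * z powr p" if "0 \<le> s" "s \<le> 1" "0 \<le> z" for s z :: real
  proof -
    have "s powr p \<le> s"
      using powr_mono'[of 1 p s] that p by (cases "s = 0") auto
    then show ?thesis
      using that by (simp add: powr_mult mult_right_mono)
  qed
  consider "x = 0" | "y = 0" | "0 < x" "0 < y" using xy by linarith
  then show ?thesis
  proof cases
    case 1 then show ?thesis using scale[of "1 - t" y] t xy p by simp
  next
    case 2 then show ?thesis using scale[of t x] t xy p by simp
  next
    case 3
    then show ?thesis
      using convex_onD[OF powr_convex[OF p], of "1 - t" x y] t by (simp add: algebra_simps)
  qed
qed

lemma lp_norm_nonneg [simp]: "0 \<le> lp_norm p x"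
  by (simp add: lp_norm_def)

lemma lp_norm_powr:
  assumes "1 \<le> p" "x \<in> lp_space p"
  shows "lp_norm p x powr p = (\<Sum>n. \<bar>x n\<bar> powr p)"
proof -
  have "0 \<le> (\<Sum>n. \<bar>x n\<bar> powr p)"
    using assms by (intro suminf_nonneg) (auto simp: lp_space_def)
  then show ?thesis using assms by (simp add: lp_norm_def powr_powr)
qed

lemma lp_norm_eq_0:
  assumes "1 \<le> p" "x \<in> lp_space p"
  shows "lp_norm p x = 0 \<longleftrightarrow> (\<forall>n. x n = 0)"
  using assms by (auto simp: lp_norm_def lp_space_def suminf_eq_zero_iff)

lemma lp_scale_le:
  assumes p: "1 \<le> p" and x: "x \<in> lp_space p" and M: "0 \<le> M"
    and le: "\<And>n. \<bar>y n\<bar> \<le> M * \<bar>x n\<bar>"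
  shows "y \<in> lp_space p" "lp_norm p y \<le> M * lp_norm p x"
proof -
  have le': "\<bar>y n\<bar> powr p \<le> M powr p * \<bar>x n\<bar> powr p" for n
    using powr_mono2[OF _ _ le[of n], of p] p M by (simp add: powr_mult)
  have sx: "summable (\<lambda>n. M powr p * \<bar>x n\<bar> powr p)"
    using x by (auto simp: lp_space_def intro: summable_mult)
  show y: "y \<in> lp_space p"
    unfolding lp_space_def mem_Collect_eq
    by (rule summable_comparison_test'[OF sx]) (use le' in auto)
  have "(\<Sum>n. \<bar>y n\<bar> powr p) \<le> (\<Sum>n. M powr p * \<bar>x n\<bar> powr p)"
    using y sx le' by (intro suminf_le) (auto simp: lp_space_def)
  also have "\<dots> = M powr p * (\<Sum>n. \<bar>x n\<bar> powr p)"
    using x by (intro suminf_mult) (auto simp: lp_space_def)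
  finally have "lp_norm p y powr p \<le> (M * lp_norm p x) powr p"
    using lp_norm_powr[OF p x] lp_norm_powr[OF p y] M by (simp add: powr_mult)
  then show "lp_norm p y \<le> M * lp_norm p x"
    using p M by (smt (verit) lp_norm_nonneg mult_nonneg_nonneg powr_less_mono2)
qed

lemma lp_Minkowski:
  assumes p: "1 \<le> p" and x: "x \<in> lp_space p" and y: "y \<in> lp_space p"
  shows "(\<lambda>n. x n + y n) \<in> lp_space p"
    and "lp_norm p (\<lambda>n. x n + y n) \<le> lp_norm p x + lp_norm p y"
proof -
  define a b where "a = lp_norm p x" and "b = lp_norm p y"
  have ab: "0 \<le> a" "0 \<le> b" by (simp_all add: a_def b_def)
  let ?z = "\<lambda>n. x n + y n"
  have "?z \<in> lp_space p \<and> lp_norm p ?z \<le> a + b"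
  proof -
    consider "a = 0" | "b = 0" | "0 < a" "0 < b" using ab by linarith
    then show ?thesis
    proof cases
      case 1
      then have "x n = 0" for n using lp_norm_eq_0[OF p x] by (simp add: a_def)
      then show ?thesis using y 1 by (simp add: b_def)
    next
      case 2
      then have "y n = 0" for n using lp_norm_eq_0[OF p y] by (simp add: b_def)
      then show ?thesis using x 2 by (simp add: a_def)
    next
      case 3
      define t where "t = a / (a + b)"
      have t: "0 \<le> t" "t \<le> 1" "1 - t = b / (a + b)"
        using 3 by (auto simp: t_def field_simps)
      let ?g = "\<lambda>n. t / a powr p * \<bar>x n\<bar> powr p + (1 - t) / b powr p * \<bar>y n\<bar> powr p"
      have le: "\<bar>?z n\<bar> powr p / (a + b) powr p \<le> ?g n" for n
      proof -
        have "\<bar>?z n\<bar> / (a + b) \<le> (\<bar>x n\<bar> + \<bar>y n\<bar>) / (a + b)"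
          using 3 by (intro divide_right_mono) auto
        also have "\<dots> = t * (\<bar>x n\<bar> / a) + (1 - t) * (\<bar>y n\<bar> / b)"
          using 3 by (simp add: t(3)) (simp add: t_def add_divide_distrib)
        finally have "(\<bar>?z n\<bar> / (a + b)) powr p \<le> (t * (\<bar>x n\<bar> / a) + (1 - t) * (\<bar>y n\<bar> / b)) powr p"
          using 3 p by (intro powr_mono2) auto
        also have "\<dots> \<le> t * (\<bar>x n\<bar> / a) powr p + (1 - t) * (\<bar>y n\<bar> / b) powr p"
          using 3 p t by (intro powr_convex_nonneg) auto
        finally show ?thesis using 3 by (simp add: powr_divide)
      qed
      have sums: "(\<lambda>n. t / a powr p * \<bar>x n\<bar> powr p) sums (t / a powr p * a powr p)"
        "(\<lambda>n. (1 - t) / b powr p * \<bar>y n\<bar> powr p) sums ((1 - t) / b powr p * b powr p)"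
        using x y unfolding a_def b_def lp_norm_powr[OF p x] lp_norm_powr[OF p y]
        by (intro sums_mult summable_sums; simp add: lp_space_def)+
      have gs: "?g sums 1"
        using sums_add[OF sums] 3 by simp
      have sz: "summable (\<lambda>n. \<bar>?z n\<bar> powr p / (a + b) powr p)"
        by (rule summable_comparison_test'[OF sums_summable[OF gs]]) (use le in auto)
      then have z: "?z \<in> lp_space p"
        using summable_mult[OF sz, of "(a + b) powr p"] 3 by (simp add: lp_space_def)
      have "(\<Sum>n. \<bar>?z n\<bar> powr p) / (a + b) powr p = (\<Sum>n. \<bar>?z n\<bar> powr p / (a + b) powr p)"
        using z by (simp add: lp_space_def suminf_divide)
      also have "\<dots> \<le> 1"
        using suminf_le[OF le sz sums_summable[OF gs]] sums_unique[OF gs] by simp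
      finally have "lp_norm p ?z powr p \<le> (a + b) powr p"
        using 3 lp_norm_powr[OF p z] by (simp add: field_simps)
      then have "lp_norm p ?z \<le> a + b"
        using p 3 by (smt (verit) lp_norm_nonneg powr_less_mono2)
      with z show ?thesis by simp
    qed
  qed
  then show "?z \<in> lp_space p" "lp_norm p ?z \<le> lp_norm p x + lp_norm p y"
    unfolding a_def b_def by blast+
qed

lemma lp_space_diff:
  assumes p: "1 \<le> p" and "x \<in> lp_space p" "y \<in> lp_space p"
  shows "(\<lambda>n. x n - y n) \<in> lp_space p"
proof -
  have "(\<lambda>n. - y n) \<in> lp_space p" using assms by (simp add: lp_space_def)
  from lp_Minkowski(1)[OF p assms(2) this] show ?thesis by simp
qed

lemma Metric_space_lp:
  assumes p: "1 \<le> p"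
  shows "Metric_space (lp_space p) (lp_dist p)"
proof
  show "0 \<le> lp_dist p x y" "lp_dist p x y = lp_dist p y x" for x y
    by (simp_all add: lp_dist_def lp_norm_def abs_minus_commute)
  show "lp_dist p x y = 0 \<longleftrightarrow> x = y" if "x \<in> lp_space p" "y \<in> lp_space p" for x y
    using lp_norm_eq_0[OF p lp_space_diff[OF p that]] by (auto simp: lp_dist_def)
  show "lp_dist p x z \<le> lp_dist p x y + lp_dist p y z"
    if "x \<in> lp_space p" "y \<in> lp_space p" "z \<in> lp_space p" for x y z
    using lp_Minkowski(2)[OF p lp_space_diff[OF p that(1,2)] lp_space_diff[OF p that(2,3)]]
    by (simp add: lp_dist_def)
qed

lemma topspace_lp_norm_topology: "1 \<le> p \<Longrightarrow> topspace (lp_norm_topology p) = lp_space p"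
  by (simp add: lp_norm_topology_def Metric_space.topspace_mtopology Metric_space_lp)

lemma topspace_lp_pointwise_topology: "topspace (lp_pointwise_topology p) = lp_space p"
  by (simp add: lp_pointwise_topology_def)


text \<open>Weighted shifts with bounded weights are continuous operators in both topologies.\<close>

lemma weighted_shift_lp:
  assumes p: "1 \<le> p" and w: "\<And>n. \<bar>w n\<bar> \<le> M" and x: "x \<in> lp_space p"
  shows "weighted_shift w x \<in> lp_space p" "lp_norm p (weighted_shift w x) \<le> M * lp_norm p x"
proof -
  let ?s = "\<lambda>n. x (Suc n)"
  have M: "0 \<le> M" using w[of 0] by linarith
  have sx: "summable (\<lambda>n. \<bar>x n\<bar> powr p)" using x by (simp add: lp_space_def)
  then have s: "?s \<in> lp_space p"
    using summable_Suc_iff[of "\<lambda>n. \<bar>x n\<bar> powr p"] by (simp add: lp_space_def)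
  have "lp_norm p ?s \<le> lp_norm p x"
  proof -
    have "0 \<le> (\<Sum>n. \<bar>?s n\<bar> powr p)"
      using s by (intro suminf_nonneg) (auto simp: lp_space_def)
    then show ?thesis
      using suminf_split_head[OF sx] p unfolding lp_norm_def by (intro powr_mono2) auto
  qed
  moreover have le: "\<bar>weighted_shift w x n\<bar> \<le> M * \<bar>?s n\<bar>" for n
    using w by (simp add: weighted_shift_def abs_mult mult_right_mono)
  note lp_scale_le[OF p s M le]
  ultimately show "weighted_shift w x \<in> lp_space p"
    "lp_norm p (weighted_shift w x) \<le> M * lp_norm p x"
    using M by (auto intro: order_trans mult_left_mono)
qed

lemma continuous_map_weighted_shift_norm:
  assumes p: "1 \<le> p" and w: "\<And>n. \<bar>w n\<bar> \<le> M"
  shows "continuous_map (lp_norm_topology p) (lp_norm_topology p) (weighted_shift w)"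
proof -
  have M: "0 \<le> M" using w[of 0] by linarith
  have lip: "lp_dist p (weighted_shift w x) (weighted_shift w y) \<le> M * lp_dist p x y"
    if "x \<in> lp_space p" "y \<in> lp_space p" for x y
  proof -
    have eq: "(\<lambda>n. weighted_shift w x n - weighted_shift w y n) = weighted_shift w (\<lambda>n. x n - y n)"
      by (rule ext) (simp add: weighted_shift_def right_diff_distrib)
    show ?thesis
      unfolding lp_dist_def eq
      by (rule weighted_shift_lp(2)[where M = M, OF p w lp_space_diff[OF p that]])
  qed
  have "\<exists>\<delta>>0. \<forall>x. x \<in> lp_space p \<and> lp_dist p a x < \<delta> \<longrightarrow>
          lp_dist p (weighted_shift w a) (weighted_shift w x) < e"
    if a: "a \<in> lp_space p" and e: "0 < e" for a and e :: real
  proof -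
    have "lp_dist p (weighted_shift w a) (weighted_shift w x) < e"
      if x: "x \<in> lp_space p" "lp_dist p a x < e / (M + 1)" for x
    proof -
      have "M * lp_dist p a x \<le> (M + 1) * lp_dist p a x"
        by (rule mult_right_mono) (simp_all add: lp_dist_def)
      also have "\<dots> < e"
        using x(2) M by (simp add: pos_less_divide_eq mult.commute)
      finally show ?thesis
        using lip[OF a x(1)] by linarith
    qed
    moreover have "0 < e / (M + 1)" using e M by simp
    ultimately show ?thesis by (intro exI[of _ "e / (M + 1)"]) simp
  qed
  moreover have "weighted_shift w ` lp_space p \<subseteq> lp_space p"
    by (rule image_subsetI) (rule weighted_shift_lp(1)[where M = M, OF p w])
  ultimately show ?thesis
    unfolding lp_norm_topology_def
    by (subst Metric_space.metric_continuous_map[OF Metric_space_lp[OF p] Metric_space_lp[OF p]])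
      blast
qed

lemma continuous_map_weighted_shift_pointwise:
  assumes p: "1 \<le> p" and w: "\<And>n. \<bar>w n\<bar> \<le> M"
  shows "continuous_map (lp_pointwise_topology p) (lp_pointwise_topology p) (weighted_shift w)"
proof -
  have "continuous_map (lp_pointwise_topology p) euclideanreal (\<lambda>x. x (Suc n))" for n
    unfolding lp_pointwise_topology_def
    by (rule continuous_map_from_subtopology, rule continuous_map_product_projection) simp
  then have "continuous_map (lp_pointwise_topology p) euclideanreal (\<lambda>x. weighted_shift w x n)" for n
    unfolding weighted_shift_def by (rule continuous_map_real_mult_left)
  then have "continuous_map (lp_pointwise_topology p) (product_topology (\<lambda>_. euclideanreal) UNIV)
      (weighted_shift w)"
    by (simp only: continuous_map_componentwise_UNIV simp_thms)
  moreover have "weighted_shift w \<in> topspace (lp_pointwise_topology p) \<rightarrow> lp_space p"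
    unfolding topspace_lp_pointwise_topology
    by (rule funcsetI) (rule weighted_shift_lp(1)[where M = M, OF p w])
  ultimately have "continuous_map (lp_pointwise_topology p)
      (subtopology (product_topology (\<lambda>_. euclideanreal) UNIV) (lp_space p)) (weighted_shift w)"
    unfolding continuous_map_in_subtopology by blast
  then show ?thesis
    by (simp only: lp_pointwise_topology_def)
qed

end

theory Submission
  imports Defs
begin

text \<open>
  Let \<open>W n = w 1 * \<dots> * w n\<close> and \<open>\<mu> n = W n powr - p\<close>. Writing \<open>x n = y n / W n\<close>, the \<open>k\<close>-th coordinate of
  the \<open>n\<close>-th iterate of \<open>x\<close> is \<open>y (n + k) / W k\<close>, while \<open>x\<close> lies in \<open>\<ell>\<^sub>p\<close> iff
  \<open>\<Sum>n. \<bar>y n\<bar> powr p * \<mu> n\<close> converges.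

  If \<open>\<mu>\<close> is not summable, there is no norm upper frequently hypercyclic vector: its visits to
  a ball around the first unit vector form a set \<open>E\<close> of positive upper density for which
  \<open>\<Sum>k | n + k \<in> E. \<mu> k\<close> is bounded uniformly in \<open>n \<in> E\<close>, whereas some \<open>n \<in> E\<close> is followed by points of \<open>E\<close>
  with density bounded below on all windows up to a given length.
  If \<open>liminf n * \<mu> n = 0\<close>, one can fill sparse windows \<open>[2 * M, 3 * M)\<close> of \<open>y\<close> with periodic repetitions
  of finite lists at small cost. Both conditions on \<open>\<mu>\<close> are compatible with \<open>w\<close> decreasing to \<open>1\<close>.
\<close>

section \<open>Positive upper density against a divergent weight\<close>

text \<open>Summation by parts: with \<open>H L = sum h {..<L}\<close>, the right side equals
  \<open>\<mu> K * H K\<close> plus the sum of \<open>(\<mu> (L - 1) - \<mu> L) * H L\<close> over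
  \<open>1 \<le> L \<le> K\<close>, whose terms are nonnegative.\<close>

lemma sum_mult_decseq_ge:
  fixes h \<mu> :: "nat \<Rightarrow> real"
  assumes dec: "decseq \<mu>" and h: "\<And>L. L \<le> K \<Longrightarrow> 0 \<le> sum h {..<L}"
  shows "\<mu> K * sum h {..<K} \<le> (\<Sum>k<K. \<mu> k * h k)"
  using h
proof (induction K)
  case (Suc K)
  have "\<mu> (Suc K) * sum h {..<Suc K} \<le> \<mu> K * sum h {..<Suc K}"
    using dec Suc.prems[of "Suc K"] by (intro mult_right_mono) (auto simp: decseq_def)
  also have "\<dots> = \<mu> K * sum h {..<K} + \<mu> K * h K"
    by (simp add: distrib_left)
  also have "\<dots> \<le> (\<Sum>k<Suc K. \<mu> k * h k)"
    using Suc by simp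
  finally show ?case .
qed simp

text \<open>If every point of \<open>E\<close> started a short window of low density, then these windows
  and the points outside \<open>E\<close> would tile an initial segment, which would then have low density.\<close>

lemma upper_density_pos_leader:
  assumes "0 < upper_density E"
  obtains d :: real where "0 < d"
    "\<And>K. \<exists>n\<in>E. \<forall>L\<le>K. d * real L \<le> real (card (E \<inter> {n..<n + L}))"
proof -
  obtain c where c: "0 < c" "c < upper_density E"
    using assms dense by blast
  obtain r where r: "c = ereal r"
    using c by (cases c) auto
  have r0: "0 < r" using c r by simp
  have freq: "\<exists>N\<ge>m. r * (real N + 1) < real (card (E \<inter> {0..<N}))" for m
  proof (rule ccontr)
    assume "\<not> ?thesis"
    then have "\<forall>\<^sub>F n in sequentially. ereal (real (card (E \<inter> {0..<n})) / (real n + 1)) \<le> c"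
      unfolding eventually_sequentially r
      by (intro exI[of _ m]) (auto simp: field_simps not_less)
    then have "upper_density E \<le> c"
      unfolding upper_density_def by (rule Limsup_bounded)
    then show False using c by simp
  qed
  \<comment> \<open>Half of \<open>r\<close> goes to the tiling and the other half absorbs its error
    \<open>d * K\<close>: for \<open>N \<ge> K\<close>,
    \<open>d * N + d * K \<le> r * N\<close>.\<close>
  define d where "d = r / 2"
  have d: "0 < d" using r0 by (simp add: d_def)
  have "\<exists>n\<in>E. \<forall>L\<le>K. d * real L \<le> real (card (E \<inter> {n..<n + L}))" for K
  proof (rule ccontr)
    assume "\<not> ?thesis"
    then have neg: "\<exists>L\<le>K. real (card (E \<inter> {n..<n + L})) < d * real L" if "n \<in> E" for n
      using that by (auto simp: not_le)
    \<comment> \<open>The summand \<open>d * K\<close> pays for one last window that may run past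
      \<open>N\<close>.\<close>
    have tile: "real (card (E \<inter> {a..<N})) \<le> d * (real N - real a) + d * real K" if "a \<le> N" for a N
      using that
    proof (induction "N - a" arbitrary: a rule: less_induct)
      case less
      show ?case
      proof (cases "a < N")
        case False
        then show ?thesis using d less.prems by simp
      next
        case True
        show ?thesis
        proof (cases "a \<in> E")
          case False
          then have "E \<inter> {a..<N} = E \<inter> {Suc a..<N}"
            using True by (auto simp: Suc_le_eq order.order_iff_strict)
          then have "card (E \<inter> {a..<N}) = card (E \<inter> {Suc a..<N})" by simp
          moreover have "real (card (E \<inter> {Suc a..<N})) \<le> d * (real N - real (Suc a)) + d * real K"
            using True by (intro less.hyps) auto
          moreover have "d * (real N - real (Suc a)) \<le> d * (real N - real a)"
            using d by simp
          ultimately show ?thesis by linarith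
        next
          case aE: True
          obtain L where L: "L \<le> K" "real (card (E \<inter> {a..<a + L})) < d * real L"
            using neg[OF aE] by blast
          \<comment> \<open>The strict bound excludes \<open>L = 0\<close>, so the induction moves
            to a strictly shorter segment.\<close>
          have L0: "0 < L" using L(2) by (cases L) auto
          show ?thesis
          proof (cases "a + L \<le> N")
            case le: True
            have "E \<inter> {a..<N} = (E \<inter> {a..<a + L}) \<union> (E \<inter> {a + L..<N})"
              using le by auto
            then have "card (E \<inter> {a..<N}) \<le> card (E \<inter> {a..<a + L}) + card (E \<inter> {a + L..<N})"
              by (simp add: card_Un_le)
            moreover have "real (card (E \<inter> {a + L..<N})) \<le> d * (real N - real (a + L)) + d * real K"
              using le L0 True by (intro less.hyps) auto
            ultimately show ?thesis
              using L(2) by (simp add: algebra_simps)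
          next
            case False
            have "card (E \<inter> {a..<N}) \<le> card (E \<inter> {a..<a + L})"
              using False by (intro card_mono) auto
            moreover have "d * real L \<le> d * real K" using L d by simp
            moreover have "0 \<le> d * (real N - real a)" using d True by simp
            ultimately show ?thesis using L(2) by linarith
          qed
        qed
      qed
    qed
    obtain N where N: "N \<ge> K" "r * (real N + 1) < real (card (E \<inter> {0..<N}))"
      using freq by blast
    have "real (card (E \<inter> {0..<N})) \<le> d * real N + d * real K"
      using tile[of 0 N] by simp
    also have "\<dots> \<le> d * real N + d * real N" using N d by simp
    also have "\<dots> = r * real N" by (simp add: d_def)
    finally show False using N(2) r0 by (simp add: algebra_simps)
  qed
  with d show thesis by (rule that)
qed

text \<open>First \<open>K\<close> is fixed with \<open>d * sum \<mu> {..<K}\<close> above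
  \<open>C\<close>, then \<open>n\<close> is taken from \<open>upper_density_pos_leader\<close> for
  this \<open>K\<close>. The indicator of \<open>E\<close> seen from \<open>n\<close>, minus the
  constant \<open>d\<close>, has nonnegative partial sums up to \<open>K\<close>, so by
  \<open>sum_mult_decseq_ge\<close> its weighted sum is nonnegative.\<close>

lemma upper_density_pos_divergent:
  fixes \<mu> :: "nat \<Rightarrow> real"
  assumes E: "0 < upper_density E" and dec: "decseq \<mu>" and nn: "\<And>k. 0 \<le> \<mu> k"
    and div: "\<not> summable \<mu>"
  shows "\<exists>n\<in>E. \<exists>K. C < (\<Sum>k | k < K \<and> n + k \<in> E. \<mu> k)"
proof -
  obtain d where d: "0 < d"
    and lead: "\<And>K. \<exists>n\<in>E. \<forall>L\<le>K. d * real L \<le> real (card (E \<inter> {n..<n + L}))"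
    using upper_density_pos_leader[OF E] by metis
  obtain K where K: "C / d < sum \<mu> {..<K}"
    using div summableI_nonneg_bounded[of \<mu> "C / d"] nn by (meson not_le)
  obtain n where n: "n \<in> E" "\<And>L. L \<le> K \<Longrightarrow> d * real L \<le> real (card (E \<inter> {n..<n + L}))"
    using lead by blast
  define h where "h k = of_bool (n + k \<in> E) - d" for k
  have sum_h: "sum h {..<L} = real (card (E \<inter> {n..<n + L})) - d * real L" for L
  proof -
    have "E \<inter> {n..<n + L} = (+) n ` {k \<in> {..<L}. n + k \<in> E}"
      by (auto simp: image_iff) (metis le_add_diff_inverse less_diff_conv2 add.commute)
    then have "card (E \<inter> {n..<n + L}) = card {k \<in> {..<L}. n + k \<in> E}"
      by (simp add: card_image)
    then show ?thesis
      by (simp add: h_def sum_subtractf sum.If_cases of_bool_def Int_def mult.commute)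
  qed
  have "0 \<le> \<mu> K * sum h {..<K}"
    using nn n(2)[of K] by (simp add: sum_h)
  also have "\<dots> \<le> (\<Sum>k<K. \<mu> k * h k)"
    by (rule sum_mult_decseq_ge[OF dec]) (use n(2) sum_h in simp)
  also have "\<dots> = (\<Sum>k<K. \<mu> k * of_bool (n + k \<in> E)) - d * sum \<mu> {..<K}"
    by (simp add: h_def right_diff_distrib sum_subtractf sum_distrib_left mult.commute)
  also have "(\<Sum>k<K. \<mu> k * of_bool (n + k \<in> E)) = (\<Sum>k | k < K \<and> n + k \<in> E. \<mu> k)"
    by (intro sum.mono_neutral_cong_right) auto
  finally have "d * sum \<mu> {..<K} \<le> (\<Sum>k | k < K \<and> n + k \<in> E. \<mu> k)" by simp
  moreover have "C < d * sum \<mu> {..<K}"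
    using K d by (simp add: field_simps)
  ultimately show ?thesis using n(1) by (meson less_le_trans)
qed

section \<open>Weight products, iterates of the shift and bounds for the l_p norm\<close>

definition weight_prod :: "(nat \<Rightarrow> real) \<Rightarrow> nat \<Rightarrow> real" where
  "weight_prod w n = (\<Prod>i<n. w (Suc i))"

lemma weight_prod_ge_1: "(\<And>n. 1 \<le> w n) \<Longrightarrow> 1 \<le> weight_prod w n"
  unfolding weight_prod_def by (rule prod_ge_1) simp

lemma incseq_weight_prod:
  assumes "\<And>n. 1 \<le> w n"
  shows "incseq (weight_prod w)"
proof (rule incseq_SucI)
  fix n
  have "weight_prod w n * 1 \<le> weight_prod w n * w (Suc n)"
    using assms weight_prod_ge_1[of w n, OF assms] by (intro mult_left_mono) auto
  then show "weight_prod w n \<le> weight_prod w (Suc n)"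
    by (simp add: weight_prod_def)
qed

lemma decseq_weight_prod_powr:
  assumes "\<And>n. 1 \<le> w n" "0 \<le> p"
  shows "decseq (\<lambda>n. weight_prod w n powr - p)"
  unfolding decseq_def
proof (intro allI impI)
  fix m n :: nat
  assume "m \<le> n"
  then show "weight_prod w n powr - p \<le> weight_prod w m powr - p"
    using incseq_weight_prod[of w] weight_prod_ge_1[of w] assms
    by (intro powr_mono2') (auto simp: incseq_def intro: less_le_trans[OF zero_less_one])
qed

text \<open>The product of the \<open>n\<close> weights after position \<open>k\<close> becomes a
  quotient, so that the substitution \<open>x n = y n / W n\<close> cancels its numerator.\<close>

lemma funpow_weighted_shift:
  assumes "\<And>n. w n \<noteq> 0"
  shows "(weighted_shift w ^^ n) x k = weight_prod w (n + k) / weight_prod w k * x (n + k)"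
proof (induction n arbitrary: k)
  case 0
  then show ?case using assms by (simp add: weight_prod_def)
next
  case (Suc n)
  then show ?case using assms by (simp add: weighted_shift_def weight_prod_def)
qed

lemma funpow_weighted_shift_lp:
  assumes "1 \<le> p" "\<And>n. \<bar>w n\<bar> \<le> M" "x \<in> lp_space p"
  shows "(weighted_shift w ^^ n) x \<in> lp_space p"
  by (induction n) (use assms weighted_shift_lp(1)[of p w M] in auto)

lemma lp_norm_leI:
  assumes p: "1 \<le> p" and e: "0 \<le> e" and le: "\<And>N. (\<Sum>n<N. \<bar>x n\<bar> powr p) \<le> e powr p"
  shows "x \<in> lp_space p" "lp_norm p x \<le> e"
proof -
  have s: "summable (\<lambda>n. \<bar>x n\<bar> powr p)"
    by (rule summableI_nonneg_bounded[OF _ le]) simp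
  then show x: "x \<in> lp_space p" by (simp add: lp_space_def)
  have "(\<Sum>n. \<bar>x n\<bar> powr p) \<le> e powr p"
    by (rule suminf_le_const[OF s le])
  then have "lp_norm p x powr p \<le> e powr p"
    by (simp add: lp_norm_powr[OF p x])
  then show "lp_norm p x \<le> e"
    using p e by (smt (verit) lp_norm_nonneg powr_less_mono2)
qed

lemma sum_le_lp_norm:
  assumes p: "1 \<le> p" and x: "x \<in> lp_space p" and A: "finite A"
  shows "(\<Sum>n\<in>A. \<bar>x n\<bar> powr p) \<le> lp_norm p x powr p"
  unfolding lp_norm_powr[OF p x]
  by (rule sum_le_suminf) (use x A in \<open>auto simp: lp_space_def\<close>)

lemma abs_le_lp_norm:
  assumes "1 \<le> p" "x \<in> lp_space p"
  shows "\<bar>x n\<bar> \<le> lp_norm p x"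
proof -
  have "\<bar>x n\<bar> powr p \<le> lp_norm p x powr p"
    using sum_le_lp_norm[OF assms, of "{n}"] by simp
  then show ?thesis
    using assms by (smt (verit) lp_norm_nonneg powr_less_mono2)
qed

section \<open>The obstruction to norm upper frequent hypercyclicity\<close>

text \<open>Bayart and Ruzsa's necessary condition, easier here because the weight products increase.\<close>

lemma not_upper_frequently_hypercyclic_norm:
  assumes p: "1 \<le> p" and w: "\<And>n. 1 \<le> w n"
    and div: "\<not> summable (\<lambda>n. weight_prod w n powr - p)"
  shows "\<not> upper_frequently_hypercyclic (lp_norm_topology p) (weighted_shift w)"
proof
  interpret Metric_space "lp_space p" "lp_dist p" by (rule Metric_space_lp[OF p])
  let ?W = "weight_prod w"
  have W1: "1 \<le> ?W n" for n by (rule weight_prod_ge_1[of w n, OF w])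
  have W0: "0 < ?W n" for n using W1[of n] by linarith
  have w0: "w n \<noteq> 0" for n using w[of n] by auto
  assume "upper_frequently_hypercyclic (lp_norm_topology p) (weighted_shift w)"
  then obtain x where
    freq: "\<And>U. openin mtopology U \<Longrightarrow> U \<noteq> {} \<Longrightarrow> 0 < upper_density {n. (weighted_shift w ^^ n) x \<in> U}"
    unfolding upper_frequently_hypercyclic_def lp_norm_topology_def by blast
  define u :: "nat \<Rightarrow> real" where "u n = of_bool (n = 0)" for n
  have u: "u \<in> lp_space p" "lp_norm p u \<le> 1"
  proof -
    have "(\<Sum>n<N. \<bar>u n\<bar> powr p) \<le> 1 powr p" for N
    proof -
      have "(\<Sum>n<N. \<bar>u n\<bar> powr p) \<le> (\<Sum>n<N. if n = 0 then 1 else 0)"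
        by (intro sum_mono) (simp add: u_def)
      then show ?thesis by (cases N) (simp_all add: sum.delta split: if_splits)
    qed
    then show "u \<in> lp_space p" "lp_norm p u \<le> 1"
      using lp_norm_leI[OF p, of 1 u] by auto
  qed
  define E where "E = {n. (weighted_shift w ^^ n) x \<in> mball u (1/2)}"
  have "u \<in> mball u (1/2)" using u(1) by simp
  then have "0 < upper_density E"
    unfolding E_def by (intro freq openin_mball) blast
  \<comment> \<open>Vectors of the ball have zeroth coordinate at least \<open>1/2\<close> in
    absolute value and norm at most \<open>3/2\<close>. The threshold is
    \<open>3 powr p = 2 powr p * (3/2) powr p\<close>.\<close>
  from upper_density_pos_divergent[OF this decseq_weight_prod_powr[of w p, OF w] _ div, of "3 powr p"] p
  obtain n K where n: "n \<in> E" "3 powr p < (\<Sum>k | k < K \<and> n + k \<in> E. ?W k powr - p)"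
    by auto
  define z where "z = (weighted_shift w ^^ n) x"
  have z: "z \<in> lp_space p" "lp_norm p (\<lambda>n. u n - z n) < 1/2"
    using n(1) by (auto simp: E_def z_def lp_dist_def)
  have big: "1/2 \<le> ?W m * \<bar>x m\<bar>" if "m \<in> E" for m
  proof -
    let ?y = "(weighted_shift w ^^ m) x"
    have y: "?y \<in> lp_space p" "lp_norm p (\<lambda>n. u n - ?y n) < 1/2"
      using that by (auto simp: E_def lp_dist_def)
    have "\<bar>u 0 - ?y 0\<bar> < 1/2"
      using abs_le_lp_norm[OF p lp_space_diff[OF p u(1) y(1)], of 0] y(2) by linarith
    moreover have "u 0 = 1" by (simp add: u_def)
    ultimately have "1/2 \<le> \<bar>?y 0\<bar>" by linarith
    also have "?y 0 = ?W m * x m"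
      by (simp add: funpow_weighted_shift[of w, OF w0]) (simp add: weight_prod_def)
    finally show ?thesis using W0[of m] by (simp add: abs_mult)
  qed
  \<comment> \<open>Every visit time \<open>n + k\<close> leaves a trace in the single vector
    \<open>z\<close>: \<open>z k\<close> is \<open>?W (n + k) * x (n + k)\<close>, bounded below by
    \<open>big\<close>, divided by \<open>?W k\<close>.\<close>
  have low: "?W k powr - p \<le> 2 powr p * \<bar>z k\<bar> powr p" if "n + k \<in> E" for k
  proof -
    have "1 / ?W k \<le> 2 * (?W (n + k) * \<bar>x (n + k)\<bar>) / ?W k"
      using big[OF that] W0[of k] by (intro divide_right_mono) auto
    also have "\<dots> = 2 * \<bar>z k\<bar>"
      using W0[of "n + k"] W0[of k] by (simp add: z_def funpow_weighted_shift[of w, OF w0] abs_mult)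
    finally have "(1 / ?W k) powr p \<le> (2 * \<bar>z k\<bar>) powr p"
      using p W0[of k] by (intro powr_mono2) auto
    then show ?thesis
      using W0[of k] by (simp add: powr_mult powr_divide powr_minus_divide)
  qed
  have "lp_norm p (\<lambda>n. u n + - (u n - z n)) \<le> lp_norm p u + lp_norm p (\<lambda>n. - (u n - z n))"
    using lp_space_diff[OF p z(1) u(1)] by (intro lp_Minkowski(2)[OF p u(1)]) simp
  also have "lp_norm p (\<lambda>n. - (u n - z n)) = lp_norm p (\<lambda>n. u n - z n)"
    by (simp add: lp_norm_def abs_minus_commute)
  finally have zn: "lp_norm p z \<le> 3/2" using u(2) z(2) by simp
  have "(\<Sum>k | k < K \<and> n + k \<in> E. ?W k powr - p) \<le> (\<Sum>k | k < K \<and> n + k \<in> E. 2 powr p * \<bar>z k\<bar> powr p)"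
    by (intro sum_mono low) auto
  also have "\<dots> = 2 powr p * (\<Sum>k | k < K \<and> n + k \<in> E. \<bar>z k\<bar> powr p)"
    by (simp add: sum_distrib_left)
  also have "\<dots> \<le> 2 powr p * lp_norm p z powr p"
    by (intro mult_left_mono sum_le_lp_norm[OF p z(1)]) auto
  also have "\<dots> \<le> 2 powr p * (3/2) powr p"
    using zn p by (intro mult_left_mono powr_mono2) auto
  also have "\<dots> = 3 powr p" by (simp flip: powr_mult)
  finally show False using n(2) by simp
qed

section \<open>A sequence that repeats every list of a countable family\<close>

lemma upper_density_geI:
  assumes "\<And>m. \<exists>n\<ge>m. c \<le> real (card (S \<inter> {0..<n})) / (real n + 1)"
  shows "ereal c \<le> upper_density S"
proof (rule ccontr)
  assume "\<not> ?thesis"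
  then have "\<forall>\<^sub>F n in sequentially. ereal (real (card (S \<inter> {0..<n})) / (real n + 1)) < ereal c"
    unfolding upper_density_def by (intro Limsup_lessD) (simp add: not_le)
  then obtain m where "\<And>n. n \<ge> m \<Longrightarrow> real (card (S \<inter> {0..<n})) / (real n + 1) < c"
    by (auto simp: eventually_sequentially)
  then show False using assms[of m] by (meson not_le)
qed

text \<open>Block \<open>i\<close> of \<open>y\<close> repeats the list \<open>U i\<close> periodically from \<open>2 * M i\<close> up to at most \<open>3 * M i\<close> and so
  has density bounded below; its weight is at most \<open>C i * M i * \<mu> (M i)\<close>, even when \<open>y\<close> is shifted
  back by up to \<open>M i\<close>. Shifting by the position of the last period of a block leaves only the later
  blocks behind the list.\<close>

lemma universal_sequence:
  fixes \<mu> :: "nat \<Rightarrow> real" and V :: "nat \<Rightarrow> real list"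
  assumes dec: "decseq \<mu>" and nn: "\<And>k. 0 \<le> \<mu> k"
    and small: "\<And>N e. 0 < e \<Longrightarrow> \<exists>n\<ge>N. real n * \<mu> n < e"
    and V: "\<And>i. V i \<noteq> []"
  obtains y :: "nat \<Rightarrow> real" where
    "summable (\<lambda>n. \<bar>y n\<bar> powr p * \<mu> n)"
    "\<And>i. 0 < upper_density {n. \<forall>k<length (V i). y (n + k) = V i ! k}"
    "\<And>i e. 0 < e \<Longrightarrow> infinite {n. (\<forall>k<length (V i). y (n + k) = V i ! k) \<and>
       (\<forall>K. (\<Sum>k = length (V i)..<K. \<bar>y (n + k)\<bar> powr p * \<mu> k) \<le> e)}"
proof -
  \<comment> \<open>Decoding pairs makes every \<open>V j\<close> recur as \<open>U i\<close> for
    arbitrarily large \<open>i\<close>.\<close>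
  define U where "U i = V (fst (prod_decode i))" for i
  define len where "len i = length (U i)" for i
  have len: "0 < len i" for i using V by (simp add: len_def U_def)
  have rep: "\<exists>i\<ge>m. U i = V j" for j m
    by (intro exI[of _ "prod_encode (j, m)"]) (simp add: U_def le_prod_encode_2)
  define C where "C i = (\<Sum>k<len i. \<bar>U i ! k\<bar> powr p)" for i
  have C0: "0 \<le> C i" for i by (simp add: C_def sum_nonneg)
  have C: "\<bar>U i ! k\<bar> powr p \<le> C i" if "k < len i" for i k
    unfolding C_def using that by (intro member_le_sum) auto
  have ex: "\<exists>m. (len i \<le> m \<and> i \<le> m \<and> C i * (real m * \<mu> m) \<le> (1/2)^i) \<and> N \<le> m" for i N
  proof -
    \<comment> \<open>\<open>C i + 1\<close> keeps the denominator positive when all entries of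
      \<open>U i\<close> vanish.\<close>
    have "0 < (1/2)^i / (C i + 1)" using C0[of i] by (intro divide_pos_pos) auto
    from small[OF this, of "max N (max i (len i))"] obtain m where
      m: "max N (max i (len i)) \<le> m" "real m * \<mu> m < (1/2)^i / (C i + 1)" by blast
    have "C i * (real m * \<mu> m) \<le> (C i + 1) * (real m * \<mu> m)"
      using nn by (intro mult_right_mono) auto
    also have "\<dots> \<le> (C i + 1) * ((1/2)^i / (C i + 1))"
      using m(2) C0[of i] by (intro mult_left_mono) auto
    also have "\<dots> = (1/2)^i" using C0[of i] by simp
    finally show ?thesis using m(1) by (intro exI[of _ m]) auto
  qed
  have "\<exists>f. \<forall>n. (len n \<le> f n \<and> n \<le> f n \<and> C n * (real (f n) * \<mu> (f n)) \<le> (1/2)^n)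
      \<and> 3 * f n \<le> f (Suc n)"
    by (rule dependent_nat_choice) (use ex in blast)+
  then obtain M where M: "\<And>i. len i \<le> M i" "\<And>i. i \<le> M i"
      "\<And>i. C i * (real (M i) * \<mu> (M i)) \<le> (1/2)^i" and M3: "\<And>i. 3 * M i \<le> M (Suc i)"
    by blast
  have M0: "0 < M i" for i using len[of i] M(1)[of i] by linarith
  have Mmono: "M i \<le> M j" if "i \<le> j" for i j
  proof (rule lift_Suc_mono_le[OF _ that])
    show "M n \<le> M (Suc n)" for n using M3[of n] by linarith
  qed
  have M3': "3 * M i \<le> M j" if "i < j" for i j
    using M3[of i] Mmono[of "Suc i" j] that by linarith
  \<comment> \<open>\<open>b n\<close> is the block in charge of \<open>n\<close>; the gap before a
    block belongs to that block. \<open>q i\<close> counts the complete copies of \<open>U i\<close>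
    that fit into \<open>[2 * M i, 3 * M i)\<close>; the remainder is filled with zeros.\<close>
  define b where "b n = (LEAST i. n < 3 * M i)" for n
  define q where "q i = M i div len i" for i
  have q1: "1 \<le> q i" for i using len[of i] M(1)[of i] by (simp add: q_def div_greater_zero_iff Suc_le_eq)
  have qlen: "q i * len i \<le> M i" for i by (simp add: q_def)
  have b1: "b n = i" if "n < 3 * M i" "\<And>j. j < i \<Longrightarrow> 3 * M j \<le> n" for n i
    unfolding b_def
  proof (rule Least_equality)
    show "n < 3 * M i" by (rule that)
    show "i \<le> j" if "n < 3 * M j" for j
      using that \<open>\<And>j. j < i \<Longrightarrow> 3 * M j \<le> n\<close>[of j] by linarith
  qed
  have b_block: "b n = i" if "2 * M i \<le> n" "n < 3 * M i" for n i
  proof (rule b1[OF that(2)])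
    show "3 * M j \<le> n" if "j < i" for j
      using M3'[OF that] \<open>2 * M i \<le> n\<close> by linarith
  qed
  have b_Suc: "b n = Suc i" if "3 * M i \<le> n" "n < 3 * M (Suc i)" for n i
  proof (rule b1[OF that(2)])
    show "3 * M j \<le> n" if "j < Suc i" for j
      using Mmono[of j i] that \<open>3 * M i \<le> n\<close> by linarith
  qed
  define y where "y n = (if 2 * M (b n) \<le> n \<and> n < 2 * M (b n) + q (b n) * len (b n)
       then U (b n) ! ((n - 2 * M (b n)) mod len (b n)) else 0)" for n
  have y_match: "y (2 * M i + r * len i + k) = U i ! k" if "r < q i" "k < len i" for i r k
  proof -
    let ?n = "2 * M i + r * len i + k"
    have "r * len i + len i \<le> q i * len i"
      using that(1) by (metis Suc_leI add.commute mult_Suc mult_le_mono1)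
    then have le: "?n < 2 * M i + q i * len i" using that(2) by linarith
    then have "b ?n = i" using qlen[of i] by (intro b_block) auto
    then show ?thesis using le that(2) by (simp add: y_def add.assoc)
  qed
  have y_bd: "\<bar>y n\<bar> powr p \<le> C (b n)" for n
    using C[of "(n - 2 * M (b n)) mod len (b n)" "b n"] len[of "b n"] C0[of "b n"]
    by (auto simp: y_def)
  have y_gap: "y n = 0" if "2 * M i + q i * len i \<le> n" "n < 2 * M (Suc i)" for n i
  proof (cases "n < 3 * M i")
    case True
    then have "b n = i" using that by (intro b_block) auto
    then show ?thesis using that by (simp add: y_def)
  next
    case False
    then have "b n = Suc i" using that by (intro b_Suc) auto
    then show ?thesis using that by (simp add: y_def)
  qed
  have step: "(\<Sum>n = 3 * M i..<3 * M (Suc i). \<bar>y n\<bar> powr p * \<mu> (n - s)) \<le> (1/2)^Suc i"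
    if s: "s \<le> 3 * M i" for i s
  proof -
    let ?c = "C (Suc i) * \<mu> (M (Suc i))"
    have "(\<Sum>n = 3 * M i..<3 * M (Suc i). \<bar>y n\<bar> powr p * \<mu> (n - s))
        = (\<Sum>n = 2 * M (Suc i)..<3 * M (Suc i). \<bar>y n\<bar> powr p * \<mu> (n - s))"
    proof (rule sum.mono_neutral_right)
      show "{2 * M (Suc i)..<3 * M (Suc i)} \<subseteq> {3 * M i..<3 * M (Suc i)}"
        using M3[of i] by auto
      show "\<forall>n\<in>{3 * M i..<3 * M (Suc i)} - {2 * M (Suc i)..<3 * M (Suc i)}.
          \<bar>y n\<bar> powr p * \<mu> (n - s) = 0"
        using y_gap[of i] qlen[of i] by auto
    qed simp
    also have "\<dots> \<le> (\<Sum>n = 2 * M (Suc i)..<3 * M (Suc i). ?c)"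
    proof (rule sum_mono)
      fix n assume n: "n \<in> {2 * M (Suc i)..<3 * M (Suc i)}"
      then have "b n = Suc i" by (intro b_block) auto
      \<comment> \<open>Here it matters that blocks start at \<open>2 * M\<close> and not at
        \<open>M\<close>: since \<open>s \<le> 3 * M i \<le> M (Suc i)\<close>, the shifted index
        \<open>n - s\<close> is still at least \<open>M (Suc i)\<close>.\<close>
      moreover have "\<mu> (n - s) \<le> \<mu> (M (Suc i))"
        using s n M3[of i] by (intro decseqD[OF dec]) auto
      ultimately show "\<bar>y n\<bar> powr p * \<mu> (n - s) \<le> ?c"
        using y_bd[of n] nn C0 by (intro mult_mono) auto
    qed
    also have "\<dots> = C (Suc i) * (real (M (Suc i)) * \<mu> (M (Suc i)))" by simp
    also have "\<dots> \<le> (1/2)^Suc i" by (rule M(3))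
    finally show ?thesis .
  qed
  have tail: "(\<Sum>n = 3 * M i..<N. \<bar>y n\<bar> powr p * \<mu> (n - s)) \<le> (1/2)^i"
    if s: "s \<le> 3 * M i" for i N s
  proof -
    let ?g = "\<lambda>n. \<bar>y n\<bar> powr p * \<mu> (n - s)"
    \<comment> \<open>The bounds \<open>(1/2)^Suc k\<close> from \<open>step\<close> form a
      geometric series, kept in closed form for the induction.\<close>
    have "sum ?g {3 * M i..<3 * M (i + j)} \<le> (1/2)^i - (1/2)^(i + j)" for j
    proof (induction j)
      case (Suc j)
      have "sum ?g {3 * M i..<3 * M (i + Suc j)}
          = sum ?g {3 * M i..<3 * M (i + j)} + sum ?g {3 * M (i + j)..<3 * M (Suc (i + j))}"
        using Mmono[of i "i + j"] Mmono[of "i + j" "Suc (i + j)"] by (simp add: sum.atLeastLessThan_concat)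
      also have "sum ?g {3 * M (i + j)..<3 * M (Suc (i + j))} \<le> (1/2)^Suc (i + j)"
        using s Mmono[of i "i + j"] by (intro step) auto
      finally show ?case using Suc by simp
    qed simp
    from this[of N] have "sum ?g {3 * M i..<3 * M (i + N)} \<le> (1/2)^i"
      by (smt (verit) zero_le_power divide_nonneg_nonneg)
    moreover have "sum ?g {3 * M i..<N} \<le> sum ?g {3 * M i..<3 * M (i + N)}"
      using M(2)[of "i + N"] nn by (intro sum_mono2) auto
    ultimately show ?thesis by linarith
  qed
  show thesis
  proof (rule that)
    show "summable (\<lambda>n. \<bar>y n\<bar> powr p * \<mu> n)"
    proof (rule summableI_nonneg_bounded)
      show "0 \<le> \<bar>y n\<bar> powr p * \<mu> n" for n using nn by simp
      fix N
      let ?g = "\<lambda>n. \<bar>y n\<bar> powr p * \<mu> n"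
      have "sum ?g {..<N} \<le> sum ?g ({..<3 * M 0} \<union> {3 * M 0..<N})"
        using nn by (intro sum_mono2) auto
      also have "\<dots> = sum ?g {..<3 * M 0} + sum ?g {3 * M 0..<N}"
        by (intro sum.union_disjoint) auto
      also have "\<dots> \<le> sum ?g {..<3 * M 0} + 1"
        using tail[of 0 0 N] by simp
      finally show "sum ?g {..<N} \<le> sum ?g {..<3 * M 0} + 1" .
    qed
  next
    fix j
    let ?l = "length (V j)" and ?S = "{n. \<forall>k<length (V j). y (n + k) = V j ! k}"
    have l: "0 < ?l" using V by simp
    \<comment> \<open>The factor 8 combines \<open>M i \<le> 2 * (q i * ?l)\<close>, a loss from
      rounding, with \<open>3 * M i + 1 \<le> 4 * M i\<close>.\<close>
    have "\<exists>n\<ge>m. 1 / (8 * real ?l) \<le> real (card (?S \<inter> {0..<n})) / (real n + 1)" for m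
    proof -
      obtain i where i: "i \<ge> m" "U i = V j" using rep by blast
      have li: "len i = ?l" by (simp add: len_def i)
      have "(\<lambda>r. 2 * M i + r * ?l) ` {..<q i} \<subseteq> ?S \<inter> {0..<3 * M i}"
      proof clarify
        fix r assume r: "r < q i"
        have "r * ?l < q i * ?l" using r l by simp
        then have "2 * M i + r * ?l < 3 * M i" using qlen[of i, unfolded li] by linarith
        then show "2 * M i + r * ?l \<in> ?S \<inter> {0..<3 * M i}"
          using y_match[OF r] by (auto simp: li i)
      qed
      then have "card ((\<lambda>r. 2 * M i + r * ?l) ` {..<q i}) \<le> card (?S \<inter> {0..<3 * M i})"
        by (rule card_mono[rotated]) simp
      moreover have "inj_on (\<lambda>r. 2 * M i + r * ?l) {..<q i}"
        using l by (auto simp: inj_on_def)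
      ultimately have "q i \<le> card (?S \<inter> {0..<3 * M i})"
        by (simp add: card_image)
      moreover have "M i \<le> 2 * (q i * ?l)"
      proof -
        have "M i = q i * ?l + M i mod ?l" by (simp add: q_def li)
        moreover have "M i mod ?l < ?l" using l by simp
        moreover have "?l \<le> q i * ?l" using q1[of i] by simp
        ultimately show ?thesis by linarith
      qed
      then have "real (M i) \<le> 2 * (real (q i) * real ?l)"
        by (metis of_nat_le_iff of_nat_mult of_nat_numeral)
      ultimately have "real (M i) \<le> 2 * (real (card (?S \<inter> {0..<3 * M i})) * real ?l)"
        using l by (smt (verit) mult_right_mono of_nat_0_le_iff of_nat_le_iff)
      moreover have "real (3 * M i) + 1 \<le> 4 * real (M i)" using M0[of i] by simp
      ultimately have "real (3 * M i) + 1 \<le> 8 * (real (card (?S \<inter> {0..<3 * M i})) * real ?l)" by linarith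
      then have "1 / (8 * real ?l) \<le> real (card (?S \<inter> {0..<3 * M i})) / (real (3 * M i) + 1)"
        using l by (simp add: field_simps)
      moreover have "m \<le> 3 * M i" using i(1) M(2)[of i] by linarith
      ultimately show ?thesis by blast
    qed
    then have "ereal (1 / (8 * real ?l)) \<le> upper_density ?S"
      by (rule upper_density_geI)
    moreover have "0 < ereal (1 / (8 * real ?l))" using l by simp
    ultimately show "0 < upper_density ?S" by (rule less_le_trans[rotated])
  next
    fix j and e :: real
    assume e: "0 < e"
    let ?l = "length (V j)"
    show "infinite {n. (\<forall>k<?l. y (n + k) = V j ! k) \<and>
       (\<forall>K. (\<Sum>k = ?l..<K. \<bar>y (n + k)\<bar> powr p * \<mu> k) \<le> e)}" (is "infinite ?S")
      unfolding infinite_nat_iff_unbounded_le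
    proof
      fix m
      obtain m' where m': "(1/2)^m' < e" using real_arch_pow_inv[OF e, of "1/2"] by auto
      obtain i where i: "i \<ge> max m m'" "U i = V j" using rep by blast
      have li: "len i = ?l" by (simp add: len_def i)
      \<comment> \<open>The last copy in block \<open>i\<close> starts here. Behind it
        \<open>y\<close> vanishes up to \<open>2 * M (Suc i)\<close>, so only the later blocks,
        controlled by \<open>tail\<close>, contribute.\<close>
      define n where "n = 2 * M i + (q i - 1) * len i"
      have nl: "n + len i = 2 * M i + q i * len i"
        using q1[of i] by (cases "q i") (auto simp: n_def)
      have n3: "n + len i \<le> 3 * M i" using qlen[of i] nl by linarith
      have "(\<Sum>k = ?l..<K. \<bar>y (n + k)\<bar> powr p * \<mu> k) \<le> e" for K
      proof -
        let ?g = "\<lambda>k. \<bar>y k\<bar> powr p * \<mu> (k - n)"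
        have "(\<Sum>k = ?l..<K. \<bar>y (n + k)\<bar> powr p * \<mu> k) = sum ?g {?l + n..<K + n}"
          by (subst sum.shift_bounds_nat_ivl) (simp add: add.commute)
        also have "\<dots> = sum ?g {3 * M i..<K + n}"
        proof (rule sum.mono_neutral_right)
          show "{3 * M i..<K + n} \<subseteq> {?l + n..<K + n}" using n3 li by auto
          show "\<forall>k\<in>{?l + n..<K + n} - {3 * M i..<K + n}. ?g k = 0"
            using y_gap[of i] nl li M3[of i] M0[of i] by auto
        qed simp
        also have "\<dots> \<le> (1/2)^i" using n3 by (intro tail) simp
        also have "\<dots> \<le> (1/2)^m'" using i(1) by (intro power_decreasing) auto
        finally show ?thesis using m' by simp
      qed
      moreover have "\<forall>k<?l. y (n + k) = V j ! k"
        using y_match[of "q i - 1" i] q1[of i] by (auto simp: n_def li i)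
      moreover have "m \<le> n" using i(1) M(2)[of i] by (simp add: n_def)
      ultimately show "\<exists>n\<ge>m. n \<in> ?S" by blast
    qed
  qed
qed

section \<open>Choice of the weights\<close>

text \<open>Between the times when the partial sums \<open>S\<close> pass \<open>2^k\<close> and \<open>2^(k+1)\<close> the increments are
  constantly \<open>exp (- 2^k)\<close>. Just after \<open>2^k\<close> this is so small that \<open>S\<close> stays
  below \<open>2^k + 2\<close> for \<open>exp (2^k)\<close> steps, hence divergence; but it is so large that
  \<open>2^(k+1)\<close> is passed within about \<open>2^(k+1) * exp (2^k)\<close> steps, far fewer than \<open>exp (2^(k+1))\<close>.\<close>

lemma slowly_divergent_exp_partial_sums:
  obtains t :: "nat \<Rightarrow> real" where "decseq t" "t \<longlonglongrightarrow> 0" "\<And>n. 0 \<le> t n"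
    "\<not> summable (\<lambda>n. exp (- sum t {..<n}))"
    "\<And>N e. 0 < e \<Longrightarrow> \<exists>n\<ge>N. real n * exp (- sum t {..<n}) < e"
proof -
  \<comment> \<open>For \<open>s \<ge> 1\<close> this is the largest power of two not exceeding
    \<open>s\<close>.\<close>
  define c :: "real \<Rightarrow> real" where "c s = 2 powr of_int \<lfloor>log 2 s\<rfloor>" for s
  define S where "S = rec_nat 1 (\<lambda>_ s. s + exp (- c s))"
  define t where "t n = exp (- c (S n))" for n
  have S_Suc: "S (Suc n) = S n + t n" and S_0: "S 0 = 1" for n
    by (simp_all add: S_def t_def)
  have t_pos: "0 < t n" for n by (simp add: t_def)
  have t_le: "t n \<le> 1" for n by (simp add: t_def c_def)
  have incS: "incseq S" by (rule incseq_SucI) (use t_pos in \<open>simp add: S_Suc less_imp_le\<close>)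
  have S1: "1 \<le> S n" for n using incseqD[OF incS, of 0 n] by (simp add: S_0)
  have S_sum: "S n = 1 + sum t {..<n}" for n by (induction n) (simp_all add: S_0 S_Suc)
  have c_mono: "c s \<le> c s'" if "1 \<le> s" "s \<le> s'" for s s'
    using that by (simp add: c_def floor_mono)
  have c_ge: "2 ^ k \<le> c s" if "2 ^ k \<le> s" for k s
  proof -
    have "real k \<le> log 2 s" using that by (simp add: le_log_of_power)
    then have "int k \<le> \<lfloor>log 2 s\<rfloor>" by (simp add: le_floor_iff)
    then have "real k \<le> of_int \<lfloor>log 2 s\<rfloor>" by linarith
    then have "2 powr real k \<le> c s" unfolding c_def by (intro powr_mono) auto
    then show ?thesis by (simp add: powr_realpow)
  qed
  have c_le: "c s \<le> 2 ^ k" if "1 \<le> s" "s < 2 ^ Suc k" for k s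
  proof -
    have "log 2 s < real (Suc k)" using that powr_realpow[of 2 "Suc k"] by (subst log_less_iff) auto
    then have "\<lfloor>log 2 s\<rfloor> < int (Suc k)" by (subst floor_less_iff) simp
    then have "of_int \<lfloor>log 2 s\<rfloor> \<le> real k" by linarith
    then have "c s \<le> 2 powr real k" unfolding c_def by (intro powr_mono) auto
    then show ?thesis by (simp add: powr_realpow)
  qed
  have dec: "decseq t"
    unfolding decseq_def t_def using c_mono[OF S1] incseqD[OF incS] by simp
  \<comment> \<open>If \<open>S\<close> stayed below \<open>B\<close>, all increments would be at
    least \<open>exp (- c B)\<close>.\<close>
  have unbdd: "\<exists>n. B \<le> S n" for B
  proof (rule ccontr)
    assume "\<not> ?thesis"
    then have lt: "S n < B" for n by (auto simp: not_le)
    have "exp (- c B) \<le> t n" for n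
      using c_mono[OF S1, of n B] lt[of n] by (simp add: t_def)
    then have "real n * exp (- c B) < B" for n
      using sum_mono[of "{..<n}" "\<lambda>_. exp (- c B)" t] lt[of n] by (simp add: S_sum)
    moreover obtain n :: nat where "B < real n * exp (- c B)"
      using reals_Archimedean3[of "exp (- c B)"] by auto
    ultimately show False by (meson less_asym)
  qed
  have pass: "\<exists>m\<ge>N. S m < 2 ^ k \<and> 2 ^ k \<le> S (Suc m)" if "S N < 2 ^ k" for k N
  proof -
    define m where "m = (LEAST m. 2 ^ k \<le> S m)"
    obtain n where "2 ^ k \<le> S n" using unbdd by blast
    then have m: "2 ^ k \<le> S m" unfolding m_def by (rule LeastI)
    then have "N < m" using that incseqD[OF incS, of m N] by (cases "m \<le> N") auto
    then obtain m' where m': "m = Suc m'" "N \<le> m'" by (cases m) auto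
    then have "S m' < 2 ^ k" using not_less_Least[of m' "\<lambda>m. 2 ^ k \<le> S m"] by (simp add: m_def)
    then show ?thesis using m m' by blast
  qed
  have ex_pow: "\<exists>k. B < 2 ^ k" for B :: real by (rule real_arch_pow) simp
  show thesis
  proof (rule that)
    show "decseq t" by (rule dec)
    show "0 \<le> t n" for n using t_pos[of n] by simp
    show "t \<longlonglongrightarrow> 0"
    proof (rule LIMSEQ_I)
      fix e :: real assume e: "0 < e"
      obtain k where k: "- ln e < 2 ^ k" using ex_pow by blast
      obtain N where N: "2 ^ k \<le> S N" using unbdd by blast
      have "norm (t n - 0) < e" if "N \<le> n" for n
      proof -
        have "2 ^ k \<le> c (S n)" using N incseqD[OF incS that] by (intro c_ge) linarith
        then have "t n < exp (ln e)" unfolding t_def using k by simp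
        then show ?thesis using e t_pos[of n] by simp
      qed
      then show "\<exists>N. \<forall>n\<ge>N. norm (t n - 0) < e" by blast
    qed
    show "\<not> summable (\<lambda>n. exp (- sum t {..<n}))"
    proof
      let ?f = "\<lambda>n. exp (- sum t {..<n})"
      assume "summable ?f"
      then obtain N where N: "\<And>m n. N \<le> m \<Longrightarrow> norm (sum ?f {m..<n}) < exp (-1)"
        unfolding summable_Cauchy by (metis exp_gt_zero)
      obtain k where "S N < 2 ^ k" using ex_pow by blast
      then obtain m' where m': "N \<le> m'" "S m' < 2 ^ k" "2 ^ k \<le> S (Suc m')"
        using pass by blast
      define m where "m = Suc m'"
      define \<theta> :: real where "\<theta> = 2 ^ k"
      have m: "N \<le> m" "\<theta> \<le> S m" "S m \<le> \<theta> + 1"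
        using m' t_le[of m'] by (simp_all add: m_def \<theta>_def S_Suc)
      have slow: "S (m + j) \<le> \<theta> + 1 + real j * exp (- \<theta>)" for j
      proof (induction j)
        case (Suc j)
        have "\<theta> \<le> c (S (m + j))"
          unfolding \<theta>_def using m(2) incseqD[OF incS, of m "m + j"] by (intro c_ge) (simp add: \<theta>_def)
        then have "t (m + j) \<le> exp (- \<theta>)" by (simp add: t_def)
        then show ?case using Suc by (simp add: S_Suc algebra_simps)
      qed (use m in simp)
      define J where "J = nat \<lceil>exp \<theta>\<rceil>"
      have J: "exp \<theta> \<le> real J" by (simp add: J_def)
      \<comment> \<open>On these indices \<open>S n \<le> \<theta> + 2\<close>, and
        \<open>S n\<close> is one more than the exponent sum. At least \<open>exp \<theta>\<close>
        such terms add up to the Cauchy threshold \<open>exp (-1)\<close>.\<close>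
      have "exp (- 1 - \<theta>) \<le> ?f n" if "n \<in> {m..<m + J}" for n
      proof -
        define j where "j = n - m"
        have j: "n = m + j" "j < J" using that by (auto simp: j_def)
        have "real j \<le> exp \<theta>" using j(2) by (simp add: J_def) linarith
        then have "real j * exp (- \<theta>) \<le> exp \<theta> * exp (- \<theta>)" by (intro mult_right_mono) auto
        then have "S n \<le> \<theta> + 2" using slow[of j] j by (simp flip: exp_add)
        then show ?thesis by (simp add: S_sum)
      qed
      then have "(\<Sum>n = m..<m + J. exp (- 1 - \<theta>)) \<le> sum ?f {m..<m + J}" by (rule sum_mono)
      moreover have "exp (-1) \<le> (\<Sum>n = m..<m + J. exp (- 1 - \<theta>))"
      proof -
        have "exp \<theta> * exp (- 1 - \<theta>) \<le> real J * exp (- 1 - \<theta>)"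
          using J by (intro mult_right_mono) auto
        then show ?thesis by (simp flip: exp_add)
      qed
      ultimately have "exp (-1) \<le> norm (sum ?f {m..<m + J})" by simp
      with N[OF m(1), of "m + J"] show False by linarith
    qed
    show "\<exists>n\<ge>N. real n * exp (- sum t {..<n}) < e" if e: "0 < e" for N and e :: real
    proof -
      \<comment> \<open>The first bound places the passage of \<open>2 ^ Suc k\<close> after
        \<open>N\<close>; the second makes the final estimate \<open>4 * exp 1 / \<theta>\<close>
        smaller than \<open>e\<close>.\<close>
      obtain k where k: "max (S N) (4 * exp 1 / e) < 2 ^ k" using ex_pow by blast
      define \<theta> :: real where "\<theta> = 2 ^ k"
      have \<theta>: "0 < \<theta>" by (simp add: \<theta>_def)
      have "S N < 2 ^ Suc k" using k S1[of N] by simp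
      then obtain m where m: "N \<le> m" "S m < 2 ^ Suc k" "2 ^ Suc k \<le> S (Suc m)"
        using pass by blast
      have "exp (- \<theta>) \<le> t i" if "i < Suc m" for i
        unfolding t_def \<theta>_def using c_le[OF S1, of i k] m(2) incseqD[OF incS, of i m] that by simp
      then have "(\<Sum>i<Suc m. exp (- \<theta>)) \<le> sum t {..<Suc m}" by (intro sum_mono) simp
      \<comment> \<open>The initial value 1 of \<open>S\<close> compensates for the overshoot
        \<open>t m \<le> 1\<close>.\<close>
      also have "\<dots> \<le> 2 * \<theta>" using m(2) t_le[of m] S_sum[of "Suc m"] by (simp add: S_Suc \<theta>_def)
      finally have le1: "real (Suc m) * exp (- \<theta>) \<le> 2 * \<theta>" by simp
      have le2: "exp (- sum t {..<Suc m}) \<le> exp (1 - 2 * \<theta>)"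
        using m(3) S_sum[of "Suc m"] by (simp add: \<theta>_def)
      have "real (Suc m) * exp (- \<theta>) * exp (- sum t {..<Suc m}) \<le> 2 * \<theta> * exp (1 - 2 * \<theta>)"
        using \<theta> by (intro mult_mono[OF le1 le2]) auto
      then have "real (Suc m) * exp (- \<theta>) * exp (- sum t {..<Suc m}) * exp \<theta> \<le> 2 * \<theta> * exp (1 - 2 * \<theta>) * exp \<theta>"
        by (rule mult_right_mono) simp
      moreover have "exp (- \<theta>) * exp \<theta> = 1" "exp (1 - 2 * \<theta>) * exp \<theta> = exp 1 / exp \<theta>"
        by (simp_all flip: exp_add exp_diff)
      ultimately have "real (Suc m) * exp (- sum t {..<Suc m}) \<le> 2 * \<theta> * exp 1 / exp \<theta>"
        by (metis mult.assoc mult.commute mult_1 times_divide_eq_right)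
      \<comment> \<open>The quadratic Taylor bound
        \<open>\<theta>\<^sup>2 / 2 \<le> exp \<theta>\<close> suffices.\<close>
      also have "\<dots> \<le> 2 * \<theta> * exp 1 / (\<theta>\<^sup>2 / 2)"
        using exp_lower_Taylor_quadratic[of \<theta>] \<theta> by (intro divide_left_mono) auto
      also have "\<dots> = 4 * exp 1 / \<theta>" using \<theta> by (simp add: power2_eq_square)
      also have "\<dots> < e" using k e \<theta> by (simp add: \<theta>_def field_simps)
      finally show ?thesis using m(1) by (intro exI[of _ "Suc m"]) auto
    qed
  qed
qed

section \<open>Open sets of both topologies and rational lists\<close>

lemma upper_density_mono:
  assumes "S \<subseteq> T"
  shows "upper_density S \<le> upper_density T"
  unfolding upper_density_def
proof (intro Limsup_mono always_eventually allI)
  fix n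
  have "card (S \<inter> {0..<n}) \<le> card (T \<inter> {0..<n})"
    using assms by (intro card_mono) auto
  then show "ereal (real (card (S \<inter> {0..<n})) / (real n + 1))
      \<le> ereal (real (card (T \<inter> {0..<n})) / (real n + 1))"
    by (simp add: divide_right_mono)
qed

text \<open>Rational entries keep the family of lists countable; an entry of \<open>y\<close>
  reaches coordinate \<open>k\<close> of an iterate divided by \<open>W k\<close>.\<close>

lemma rat_list_in_open:
  fixes G :: "nat \<Rightarrow> real set" and W :: "nat \<Rightarrow> real"
  assumes "\<And>k. open (G k)" "\<And>k. z k \<in> G k" "\<And>k. 0 < W k"
  obtains l :: "rat list" where "length l = m" "\<And>k. k < m \<Longrightarrow> of_rat (l ! k) / W k \<in> G k"
proof -
  have "\<exists>q :: rat. of_rat q / W k \<in> G k" for k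
  proof -
    obtain e where e: "0 < e" "ball (z k) e \<subseteq> G k"
      using assms open_contains_ball by blast
    have "z k * W k < (z k + e) * W k" using e assms(3)[of k] by simp
    then obtain q :: rat where "z k * W k < of_rat q" "of_rat q < (z k + e) * W k"
      using of_rat_dense by blast
    then have "of_rat q / W k \<in> ball (z k) e"
      using assms(3)[of k] by (simp add: dist_real_def field_simps abs_if)
    then show ?thesis using e(2) by blast
  qed
  then obtain q :: "nat \<Rightarrow> rat" where "\<And>k. of_rat (q k) / W k \<in> G k" by metis
  then show thesis by (intro that[of "map q [0..<m]"]) auto
qed

text \<open>A basic open set of the product constrains finitely many coordinates, so a finite list
  decides membership.\<close>

lemma lp_pointwise_open_box:
  assumes "openin (lp_pointwise_topology p) U" "z \<in> U"
  obtains G :: "nat \<Rightarrow> real set" and m where "\<And>k. open (G k)" "\<And>k. z k \<in> G k"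
    "\<And>x. x \<in> lp_space p \<Longrightarrow> (\<And>k. k < m \<Longrightarrow> x k \<in> G k) \<Longrightarrow> x \<in> U"
proof -
  obtain T where T: "openin (product_topology (\<lambda>_. euclideanreal) UNIV) T" "U = T \<inter> lp_space p"
    using assms(1) by (auto simp: lp_pointwise_topology_def openin_subtopology)
  then obtain G where G: "finite {k. G k \<noteq> UNIV}" "\<And>k. open (G k)" "z \<in> Pi UNIV G" "Pi UNIV G \<subseteq> T"
    using assms(2) unfolding openin_product_topology_alt PiE_UNIV_domain by auto
  obtain m where m: "\<And>k. G k \<noteq> UNIV \<Longrightarrow> k < m"
    using G(1) by (auto simp: finite_nat_set_iff_bounded)
  show thesis
  proof (rule that)
    show "open (G k)" "z k \<in> G k" for k using G by auto
    fix x assume x: "x \<in> lp_space p" "\<And>k. k < m \<Longrightarrow> x k \<in> G k"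
    have "x k \<in> G k" for k using x(2) m by (cases "G k = UNIV") auto
    then show "x \<in> U" using G(4) T(2) x(1) by blast
  qed
qed

text \<open>Half of \<open>e powr p\<close> bounds the tail cut off from \<open>z\<close>, the other
  half the rational approximation of the remaining coordinates.\<close>

lemma lp_approx_rat_list:
  fixes W :: "nat \<Rightarrow> real"
  assumes p: "1 \<le> p" and z: "z \<in> lp_space p" and e: "0 < e" and W: "\<And>k. 0 < W k"
  obtains l :: "rat list" where "l \<noteq> []"
    "(\<lambda>k. z k - (if k < length l then of_rat (l ! k) / W k else 0)) \<in> lp_space p"
    "lp_norm p (\<lambda>k. z k - (if k < length l then of_rat (l ! k) / W k else 0)) \<le> e"
proof -
  have ep: "0 < e powr p / 2" using e by simp
  have "summable (\<lambda>n. \<bar>z n\<bar> powr p)" using z by (simp add: lp_space_def)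
  then obtain m where m: "\<And>i n. m \<le> i \<Longrightarrow> norm (\<Sum>k = i..<n. \<bar>z k\<bar> powr p) < e powr p / 2"
    using ep unfolding summable_Cauchy by blast
  define \<delta> where "\<delta> = (e powr p / 2 / (real m + 1)) powr (1 / p)"
  have \<delta>: "0 < \<delta>" "(real m + 1) * \<delta> powr p = e powr p / 2"
    using e p nonzero_mult_div_cancel_left[of "real m + 1" "e powr p / 2"]
    by (simp_all add: \<delta>_def powr_powr del: nonzero_mult_div_cancel_left)
  \<comment> \<open>Length \<open>Suc m\<close> instead of \<open>m\<close> makes the list
    nonempty.\<close>
  obtain l :: "rat list" where l: "length l = Suc m"
    "\<And>k. k < Suc m \<Longrightarrow> of_rat (l ! k) / W k \<in> ball (z k) \<delta>"
    using rat_list_in_open[of "\<lambda>k. ball (z k) \<delta>" z W "Suc m"] W \<delta>(1) by auto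
  let ?d = "\<lambda>k. z k - (if k < length l then of_rat (l ! k) / W k else 0)"
  have le: "(\<Sum>k<N. \<bar>?d k\<bar> powr p) \<le> e powr p" for N
  proof -
    have "(\<Sum>k<N. \<bar>?d k\<bar> powr p) \<le> (\<Sum>k\<in>{..<Suc m} \<union> {Suc m..<N}. \<bar>?d k\<bar> powr p)"
      by (intro sum_mono2) auto
    also have "\<dots> = (\<Sum>k<Suc m. \<bar>?d k\<bar> powr p) + (\<Sum>k = Suc m..<N. \<bar>?d k\<bar> powr p)"
      by (intro sum.union_disjoint) auto
    also have "(\<Sum>k = Suc m..<N. \<bar>?d k\<bar> powr p) = (\<Sum>k = Suc m..<N. \<bar>z k\<bar> powr p)"
      by (intro sum.cong) (auto simp: l(1))
    also have "\<dots> \<le> e powr p / 2" using m[of "Suc m" N] by simp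
    also have "(\<Sum>k<Suc m. \<bar>?d k\<bar> powr p) \<le> (\<Sum>k<Suc m. \<delta> powr p)"
    proof (intro sum_mono powr_mono2)
      fix k assume "k \<in> {..<Suc m}"
      then show "\<bar>?d k\<bar> \<le> \<delta>" using l(2)[of k] by (auto simp: l(1) dist_real_def)
    qed (use p in auto)
    also have "\<dots> = e powr p / 2" using \<delta>(2) by (simp add: add.commute)
    finally show ?thesis by simp
  qed
  show thesis
  proof (rule that)
    show "l \<noteq> []" using l(1) by auto
    show "?d \<in> lp_space p" "lp_norm p ?d \<le> e"
      using lp_norm_leI[OF p _ le] e by auto
  qed
qed

section \<open>From the universal sequence to hypercyclic vectors\<close>

text \<open>One vector serves both claims. Pointwise, a matching initial list already puts an
  iterate into a box, and matches have positive upper density. In norm the coordinates behind the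
  list must be small too, which is known only infinitely often.\<close>

lemma hypercyclic_weighted_shift:
  assumes p: "1 \<le> p" and w: "\<And>n. 1 \<le> w n" and bdd: "\<And>n. \<bar>w n\<bar> \<le> B"
    and small: "\<And>N e. 0 < e \<Longrightarrow> \<exists>n\<ge>N. real n * weight_prod w n powr - p < e"
  shows "upper_frequently_hypercyclic (lp_pointwise_topology p) (weighted_shift w)"
    and "hypercyclic (lp_norm_topology p) (weighted_shift w)"
proof -
  interpret Metric_space "lp_space p" "lp_dist p" by (rule Metric_space_lp[OF p])
  let ?W = "weight_prod w" and ?T = "weighted_shift w"
  have W0: "0 < ?W n" for n using weight_prod_ge_1[of w n, OF w] by linarith
  have w0: "w n \<noteq> 0" for n using w[of n] by auto
  \<comment> \<open>An enumeration of the nonempty rational lists, with \<open>[0]\<close> as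
    default for codes of the empty list.\<close>
  define V :: "nat \<Rightarrow> real list" where
    "V i = map of_rat (if from_nat i = ([] :: rat list) then [0] else from_nat i)" for i
  have V_ne: "V i \<noteq> []" for i by (simp add: V_def)
  have V_ex: "\<exists>i. V i = map of_rat l" if "l \<noteq> []" for l
    by (rule exI[of _ "to_nat l"]) (simp add: V_def that)
  obtain y where y: "summable (\<lambda>n. \<bar>y n\<bar> powr p * ?W n powr - p)"
    and dens: "\<And>i. 0 < upper_density {n. \<forall>k<length (V i). y (n + k) = V i ! k}"
    and inf: "\<And>i e. 0 < e \<Longrightarrow> infinite {n. (\<forall>k<length (V i). y (n + k) = V i ! k) \<and>
       (\<forall>K. (\<Sum>k = length (V i)..<K. \<bar>y (n + k)\<bar> powr p * ?W k powr - p) \<le> e)}"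
    using universal_sequence[of "\<lambda>n. ?W n powr - p" V p, OF decseq_weight_prod_powr[of w p, OF w] _ small V_ne] p by auto
  have div_W: "(\<bar>a\<bar> / \<bar>?W k\<bar>) powr p = \<bar>a\<bar> powr p * ?W k powr - p" for a k
    using W0[of k] by (simp add: powr_divide powr_minus_divide)
  define x where "x n = y n / ?W n" for n
  have x: "x \<in> lp_space p" using y by (simp add: lp_space_def x_def div_W)
  have Tx: "(?T ^^ n) x k = y (n + k) / ?W k" for n k
    using W0[of "n + k"] by (simp add: funpow_weighted_shift[of w, OF w0] x_def)
  have Tlp: "(?T ^^ n) x \<in> lp_space p" for n
    by (rule funpow_weighted_shift_lp[of p w B, OF p bdd x])
  show "upper_frequently_hypercyclic (lp_pointwise_topology p) ?T"
    unfolding upper_frequently_hypercyclic_def topspace_lp_pointwise_topology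
  proof (intro bexI[OF _ x] allI impI)
    fix U assume U: "openin (lp_pointwise_topology p) U \<and> U \<noteq> {}"
    then obtain z where "z \<in> U" by blast
    then obtain G m where G: "\<And>k. open (G k)" "\<And>k. z k \<in> G k"
      "\<And>x. x \<in> lp_space p \<Longrightarrow> (\<And>k. k < m \<Longrightarrow> x k \<in> G k) \<Longrightarrow> x \<in> U"
      using lp_pointwise_open_box[of p U z] U by blast
    \<comment> \<open>The box needs only \<open>m\<close> entries; the extra one makes the list
      nonempty for \<open>V_ex\<close>.\<close>
    obtain l :: "rat list" where l: "length l = Suc m" "\<And>k. k < Suc m \<Longrightarrow> of_rat (l ! k) / ?W k \<in> G k"
      using rat_list_in_open[of G z ?W, OF G(1,2) W0] by blast
    obtain i where i: "V i = map of_rat l" using V_ex[of l] l(1) by fastforce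
    have "{n. \<forall>k<length (V i). y (n + k) = V i ! k} \<subseteq> {n. (?T ^^ n) x \<in> U}"
      using l by (auto intro!: G(3)[OF Tlp] simp: Tx i)
    then show "0 < upper_density {n. (?T ^^ n) x \<in> U}"
      using dens[of i] upper_density_mono less_le_trans by blast
  qed
  show "hypercyclic (lp_norm_topology p) ?T"
    unfolding hypercyclic_def topspace_lp_norm_topology[OF p]
  proof (intro bexI[OF _ x] allI impI)
    fix U assume U: "openin (lp_norm_topology p) U \<and> U \<noteq> {}"
    then obtain z where z: "z \<in> U" by blast
    then obtain r where r: "0 < r" "mball z r \<subseteq> U" and zlp: "z \<in> lp_space p"
      using U unfolding lp_norm_topology_def openin_mtopology by blast
    obtain l :: "rat list" where l: "l \<noteq> []"
      "(\<lambda>k. z k - (if k < length l then of_rat (l ! k) / ?W k else 0)) \<in> lp_space p" (is "?u \<in> _")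
      "lp_norm p (\<lambda>k. z k - (if k < length l then of_rat (l ! k) / ?W k else 0)) \<le> r / 3"
      using lp_approx_rat_list[of p z "r / 3" ?W, OF p zlp _ W0] r(1) by auto
    obtain i where i: "V i = map of_rat l" using V_ex[OF l(1)] by blast
    have "(?T ^^ n) x \<in> U"
      if n: "\<And>k. k < length l \<Longrightarrow> y (n + k) = of_rat (l ! k)"
        "\<And>K. (\<Sum>k = length l..<K. \<bar>y (n + k)\<bar> powr p * ?W k powr - p) \<le> (r / 3) powr p" for n
    proof -
      let ?v = "\<lambda>k. (if k < length l then of_rat (l ! k) / ?W k else 0) - (?T ^^ n) x k"
      have "(\<Sum>k<K. \<bar>?v k\<bar> powr p) \<le> (r / 3) powr p" for K
      proof -
        have "(\<Sum>k<K. \<bar>?v k\<bar> powr p) = (\<Sum>k = length l..<K. \<bar>y (n + k)\<bar> powr p * ?W k powr - p)"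
          using n(1) by (intro sum.mono_neutral_cong_right) (auto simp: Tx div_W)
        then show ?thesis using n(2) by simp
      qed
      then have v: "?v \<in> lp_space p" "lp_norm p ?v \<le> r / 3"
        using lp_norm_leI[OF p, of "r / 3" ?v] r(1) by auto
      have "lp_dist p z ((?T ^^ n) x) < r"
        using lp_Minkowski(2)[OF p l(2) v(1)] l(3) v(2) r(1) by (simp add: lp_dist_def)
      then show ?thesis using r(2) zlp Tlp[of n] by auto
    qed
    then have "{n. (\<forall>k<length (V i). y (n + k) = V i ! k) \<and>
       (\<forall>K. (\<Sum>k = length (V i)..<K. \<bar>y (n + k)\<bar> powr p * ?W k powr - p) \<le> (r / 3) powr p)}
       \<subseteq> {n. (?T ^^ n) x \<in> U}"
      by (intro Collect_mono impI) (simp add: i)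
    then show "infinite {n. (?T ^^ n) x \<in> U}"
      by (rule infinite_super) (rule inf, use r(1) in simp)
  qed
qed

theorem theorem2p3:
  fixes p :: real
  assumes "1 \<le> p"
  shows "\<exists>w :: nat \<Rightarrow> real.
           decseq w \<and> w \<longlonglongrightarrow> 1 \<and>
           upper_frequently_hypercyclic (lp_pointwise_topology p) (weighted_shift w) \<and>
           hypercyclic (lp_norm_topology p) (weighted_shift w) \<and>
           \<not> upper_frequently_hypercyclic (lp_norm_topology p) (weighted_shift w)"
proof -
  obtain t :: "nat \<Rightarrow> real" where t: "decseq t" "t \<longlonglongrightarrow> 0" "\<And>n. 0 \<le> t n"
    and div: "\<not> summable (\<lambda>n. exp (- sum t {..<n}))"
    and small: "\<And>N e. 0 < e \<Longrightarrow> \<exists>n\<ge>N. real n * exp (- sum t {..<n}) < e"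
    using slowly_divergent_exp_partial_sums by blast
  \<comment> \<open>The index shift gives \<open>w (Suc i) = exp (t i / p)\<close>, hence the
    products in \<open>W\<close>; at 0 truncated subtraction gives \<open>w 0 = w 1\<close>, so
    \<open>w\<close> is decreasing from the start.\<close>
  define w where "w n = exp (t (n - 1) / p)" for n
  have dec: "decseq w"
    using assms decseqD[OF t(1)] by (auto simp: decseq_def w_def intro!: divide_right_mono)
  have w1: "1 \<le> w n" for n using t(3)[of "n - 1"] assms by (simp add: w_def)
  have bdd: "\<bar>w n\<bar> \<le> w 0" for n using w1[of n] decseqD[OF dec, of 0 n] by simp
  have "(\<lambda>n. exp (t n / p)) \<longlonglongrightarrow> exp (0 / p)"
    using assms by (intro tendsto_intros t(2)) auto
  then have "(\<lambda>n. w (Suc n)) \<longlonglongrightarrow> 1" by (simp add: w_def)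
  then have lim: "w \<longlonglongrightarrow> 1" by (simp only: filterlim_sequentially_Suc)
  have W: "weight_prod w n powr - p = exp (- sum t {..<n})" for n
  proof -
    have "weight_prod w n = exp (sum t {..<n} / p)"
      by (simp add: weight_prod_def w_def exp_sum sum_divide_distrib)
    then show ?thesis using assms by (simp add: exp_powr_real)
  qed
  note hypercyclic_weighted_shift[of p w "w 0", OF assms w1 bdd, unfolded W, OF small]
    not_upper_frequently_hypercyclic_norm[of p w, OF assms w1, unfolded W, OF div]
  with dec lim show ?thesis by blast
qed

end
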